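(* Let $k\ge 1$ and $0<\varepsilon<1/2$. There is a relative-error $\varepsilon$-testing algorithm for the class of $k$-juntas over $\{0,1\}^n$ that makes $O\big((k/\varepsilon)\log(k/\varepsilon)\big)$ total calls to its oracles (membership queries and random satisfying-assignment samples).
   Context: A function $f:\{0,1\}^n\to\{0,1\}$ is a $k$-junta if it depends on at most $k$ of its $n$ input variables. For $f,g:\{0,1\}^n\to\{0,1\}$ with $f^{-1}(1)\neq\emptyset$, the relative distance is $\mathrm{rel\text{-}dist}(f,g)=|f^{-1}(1)\,\triangle\, g^{-1}(1)|/|f^{-1}(1)|$, and for a class $\mathcal{C}$, $\mathrm{rel\text{-}dist}(f,\mathcal{C})=\min_{g\in\mathcal{C}}\mathrm{rel\text{-}dist}(f,g)$. A relative-error $\varepsilon$-testing algorithm for $\mathcal{C}$ is given black-box query access to the unknown $f$ (it may query $f(x)$ for any $x$) and access to an oracle returning independent uniformly random elements of $f^{-1}(1)$; it must output "accept" with probability at least $2/3$ if $f\in\mathcal{C}$, and output "reject" with probability at least $2/3$ if $\mathrm{rel\text{-}dist}(f,\mathcal{C})\ge\varepsilon$. *)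

theory Defs
  imports "HOL-Probability.Probability"
begin

definition cube :: "nat \<Rightarrow> bool list set" where
  "cube n = {x. length x = n}"

text \<open>Functions are extensional, i.e. take a fixed dummy value outside \<open>cube n\<close>; hence
  \<open>bool_funs n\<close> is the finite set of all functions from \<open>{0,1}\<^sup>n\<close> to \<open>{0,1}\<close>.\<close>

definition bool_funs :: "nat \<Rightarrow> (bool list \<Rightarrow> bool) set" where
  "bool_funs n = cube n \<rightarrow>\<^sub>E UNIV"

definition sat :: "nat \<Rightarrow> (bool list \<Rightarrow> bool) \<Rightarrow> bool list set" where
  "sat n f = {x \<in> cube n. f x}"

definition depends_on :: "nat \<Rightarrow> (bool list \<Rightarrow> bool) \<Rightarrow> nat \<Rightarrow> bool" where
  "depends_on n f i \<longleftrightarrow> i < n \<and> (\<exists>x\<in>cube n. f x \<noteq> f (x[i := \<not> x ! i]))"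

definition juntas :: "nat \<Rightarrow> nat \<Rightarrow> (bool list \<Rightarrow> bool) set" where
  "juntas n k = {f \<in> bool_funs n. card {i. depends_on n f i} \<le> k}"

definition rel_dist :: "nat \<Rightarrow> (bool list \<Rightarrow> bool) \<Rightarrow> (bool list \<Rightarrow> bool) \<Rightarrow> real" where
  "rel_dist n f g =
     real (card ((sat n f - sat n g) \<union> (sat n g - sat n f))) / real (card (sat n f))"

definition rel_dist_class ::
  "nat \<Rightarrow> (bool list \<Rightarrow> bool) \<Rightarrow> (bool list \<Rightarrow> bool) set \<Rightarrow> real" where
  "rel_dist_class n f \<C> = Min (rel_dist n f ` \<C>)"

datatype verdict = Accept | Reject

text \<open>Adaptive randomized algorithms with a membership oracle (\<open>Query\<close>) and a random
  satisfying-assignment oracle (\<open>Sample\<close>). \<open>Random\<close> is internal randomness, which is free: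
  the algorithm continues with an algorithm drawn from the given distribution.\<close>

datatype algorithm =
    Output verdict
  | Query "bool list" "bool \<Rightarrow> algorithm"
  | Sample "bool list \<Rightarrow> algorithm"
  | Random "algorithm pmf"

text \<open>The output distribution on input \<open>f\<close>; meaningful only if \<open>sat n f\<close> is nonempty.\<close>

primrec run :: "nat \<Rightarrow> (bool list \<Rightarrow> bool) \<Rightarrow> algorithm \<Rightarrow> verdict pmf" where
  "run n f (Output v) = return_pmf v"
| "run n f (Query x c) = run n f (c (f x))"
| "run n f (Sample c) = bind_pmf (pmf_of_set (sat n f)) (\<lambda>x. run n f (c x))"
| "run n f (Random p) = join_pmf (map_pmf (run n f) p)"

text \<open>\<open>calls_at_most n q A\<close>: for all internal random choices and all oracle answers, \<open>A\<close> queries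
  only points of \<open>cube n\<close> and makes at most \<open>q\<close> oracle calls, of both kinds together.\<close>

inductive calls_at_most :: "nat \<Rightarrow> nat \<Rightarrow> algorithm \<Rightarrow> bool" for n where
  Output: "calls_at_most n q (Output v)"
| Query: "x \<in> cube n \<Longrightarrow> (\<And>b. calls_at_most n q (c b)) \<Longrightarrow> calls_at_most n (Suc q) (Query x c)"
| Sample: "(\<And>x. x \<in> cube n \<Longrightarrow> calls_at_most n q (c x)) \<Longrightarrow> calls_at_most n (Suc q) (Sample c)"
| Random: "(\<And>A. A \<in> set_pmf p \<Longrightarrow> calls_at_most n q A) \<Longrightarrow> calls_at_most n q (Random p)"

definition relative_error_tester ::
  "nat \<Rightarrow> real \<Rightarrow> (bool list \<Rightarrow> bool) set \<Rightarrow> algorithm \<Rightarrow> bool" where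
  "relative_error_tester n \<epsilon> \<C> A \<longleftrightarrow>
     (\<forall>f\<in>bool_funs n. sat n f \<noteq> {} \<longrightarrow>
        (f \<in> \<C> \<longrightarrow> pmf (run n f A) Accept \<ge> 2/3) \<and>
        (rel_dist_class n f \<C> \<ge> \<epsilon> \<longrightarrow> pmf (run n f A) Reject \<ge> 2/3))"

end

theory Submission
  imports Defs
begin

text \<open>The tester colours the variables at random with \<open>r\<close> colours, \<open>r\<close> polynomial in
  \<open>k / \<epsilon>\<close>. It repeatedly samples \<open>x\<close> with \<open>f x\<close>, rerandomizes \<open>x\<close> outside the blocks found so
  far and queries the result; if \<open>f\<close> becomes false, a binary search over the colours finds a new
  block containing a relevant variable. It rejects on finding \<open>k + 1\<close> blocks, so juntas are always
  accepted.

  Let \<open>escape J\<close> be the probability that rerandomizing outside \<open>J\<close> falsifies \<open>f\<close>. Averaging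
  over the new bits gives a junta on \<open>J\<close> at relative distance at most \<open>2 * escape J\<close>, so if \<open>f\<close>
  is far from juntas then \<open>escape J \<ge> \<epsilon> / 2\<close> whenever \<open>card J \<le> k\<close>. This has to be extended
  to unions \<open>J\<close> of \<open>k\<close> blocks. As \<open>1 - escape J\<close> is the Fourier weight on subsets of \<open>J\<close>, it
  suffices that replacing \<open>J\<close> by its most influential variables, one per block, loses little
  weight. Sets of more than \<open>k\<close> variables rarely fit into \<open>k\<close> blocks, and smaller sets have total
  influence at most \<open>k\<close>, so the expected sum of products of influences over pairs of distinct
  variables in a common block is at most \<open>k\<^sup>2 / r\<close>.\<close>

section \<open>Rerandomizing coordinates\<close>

definition mix :: "nat \<Rightarrow> nat set \<Rightarrow> bool list \<Rightarrow> bool list \<Rightarrow> bool list" where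
  "mix n J x w = map (\<lambda>i. if i \<in> J then x ! i else w ! i) [0..<n]"

lemma mix_in_cube [simp]: "mix n J x w \<in> cube n"
  by (simp add: mix_def cube_def)

lemma nth_mix [simp]: "i < n \<Longrightarrow> mix n J x w ! i = (if i \<in> J then x ! i else w ! i)"
  by (simp add: mix_def)

lemma cube_eqI:
  assumes "x \<in> cube n" "y \<in> cube n" "\<And>i. i < n \<Longrightarrow> x ! i = y ! i"
  shows "x = y"
  using assms by (auto simp: cube_def intro: nth_equalityI)

text \<open>Exchanging the coordinates of \<open>x\<close> and \<open>w\<close> outside
  \<open>J\<close> is an involution on pairs; this symmetry is what
  \<open>sum_disagreement_mix\<close> needs.\<close>

lemma mix_mix_swap:
  assumes "x \<in> cube n"
  shows "mix n J (mix n J x w) (mix n J w x) = x"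
  by (rule cube_eqI) (use assms in \<open>auto split: if_splits\<close>)

lemma card_cube: "card (cube n) = 2 ^ n"
  using card_lists_length_eq[of "UNIV :: bool set" n] by (simp add: cube_def)

lemma finite_cube [simp]: "finite (cube n)"
  using card_cube[of n] card_gt_0_iff[of "cube n"] by simp

lemma cube_nonempty [simp]: "cube n \<noteq> {}"
  using card_cube[of n] by force

lemma finite_sat [simp]: "finite (sat n f)"
  by (simp add: sat_def)

lemma finite_bool_funs: "finite (bool_funs n)"
  unfolding bool_funs_def by (intro finite_PiE) auto

text \<open>Induction on the Hamming distance: flipping one differing bit of \<open>x\<close> either
  changes \<open>f\<close> or moves closer to \<open>y\<close>. That \<open>i\<close> is a differing
  coordinate is what later locates its block.\<close>

lemma depends_on_of_neq:
  assumes "x \<in> cube n" "y \<in> cube n" "f x \<noteq> f y"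
  shows "\<exists>i<n. x ! i \<noteq> y ! i \<and> depends_on n f i"
  using assms
proof (induction "card {i. i < n \<and> x ! i \<noteq> y ! i}" arbitrary: x)
  case 0
  then have "x = y" by (intro cube_eqI) auto
  with 0 show ?case by simp
next
  case (Suc d)
  then obtain i where i: "i < n" "x ! i \<noteq> y ! i"
    by (metis (mono_tags, lifting) Collect_empty_eq card.empty nat.distinct(1))
  define x' where "x' = x[i := \<not> x ! i]"
  have len: "length x = n" using Suc.prems by (simp add: cube_def)
  have x': "x' \<in> cube n" by (simp add: x'_def cube_def len)
  show ?case
  proof (cases "f x = f x'")
    case False
    then have "depends_on n f i"
      using i Suc.prems unfolding depends_on_def x'_def by blast
    with i show ?thesis by blast
  next
    case True
    have "{i. i < n \<and> x' ! i \<noteq> y ! i} = {i. i < n \<and> x ! i \<noteq> y ! i} - {i}"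
      using i len by (auto simp: x'_def nth_list_update)
    then have "d = card {i. i < n \<and> x' ! i \<noteq> y ! i}"
      using Suc.hyps(2) i by simp
    from Suc.hyps(1)[OF this x'] Suc.prems True obtain j
      where "j < n" "x' ! j \<noteq> y ! j" "depends_on n f j" by auto
    moreover have "x ! j \<noteq> y ! j"
      using calculation i len by (auto simp: x'_def nth_list_update split: if_splits)
    ultimately show ?thesis by blast
  qed
qed

section \<open>Escape probability and distance to juntas\<close>

definition escape :: "nat \<Rightarrow> (bool list \<Rightarrow> bool) \<Rightarrow> nat set \<Rightarrow> real" where
  "escape n f J =
     (\<Sum>x\<in>sat n f. \<Sum>w\<in>cube n. of_bool (\<not> f (mix n J x w))) / (real (card (sat n f)) * 2 ^ n)"

lemma escape_nonneg: "escape n f J \<ge> 0"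
  by (simp add: escape_def sum_nonneg)

text \<open>The swap involution turns a change from true to false into one from false to true, so
  both kinds are equally frequent; hence the factor 2.\<close>

lemma sum_disagreement_mix:
  "(\<Sum>w\<in>cube n. \<Sum>x\<in>cube n. of_bool (f x \<noteq> f (mix n J x w)))
     = 2 * (\<Sum>x\<in>sat n f. \<Sum>w\<in>cube n. of_bool (\<not> f (mix n J x w)) :: real)"
proof -
  define P where "P = (\<lambda>(x, w). of_bool (f x \<and> \<not> f (mix n J x w)) :: real)"
  define Q where "Q = (\<lambda>(x, w). of_bool (\<not> f x \<and> f (mix n J x w)) :: real)"
  have "sum Q (cube n \<times> cube n) = sum P (cube n \<times> cube n)"
    by (rule sum.reindex_bij_witness[where i = "\<lambda>(x, w). (mix n J x w, mix n J w x)"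
          and j = "\<lambda>(x, w). (mix n J x w, mix n J w x)"])
      (auto simp: mix_mix_swap P_def Q_def)
  moreover have "sum P (cube n \<times> cube n)
      = (\<Sum>x\<in>sat n f. \<Sum>w\<in>cube n. of_bool (\<not> f (mix n J x w)))"
    unfolding sum.cartesian_product[symmetric] P_def
    by (auto simp: sat_def sum.If_cases intro!: sum.mono_neutral_cong_right)
  moreover have "(\<Sum>w\<in>cube n. \<Sum>x\<in>cube n. of_bool (f x \<noteq> f (mix n J x w)))
      = sum P (cube n \<times> cube n) + sum Q (cube n \<times> cube n)"
    unfolding sum.distrib[symmetric]
    by (subst sum.swap, unfold sum.cartesian_product, rule sum.cong) (auto simp: P_def Q_def)
  ultimately show ?thesis by simp
qed

lemma rel_dist_eq:
  "rel_dist n f g = (\<Sum>x\<in>cube n. of_bool (f x \<noteq> g x)) / real (card (sat n f))"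
proof -
  have "(sat n f - sat n g) \<union> (sat n g - sat n f) = {x \<in> cube n. f x \<noteq> g x}"
    by (auto simp: sat_def)
  then show ?thesis
    by (simp add: rel_dist_def sum.If_cases of_bool_def Int_def)
qed

lemma mix_in_juntas:
  assumes "finite J" "card J \<le> k"
  shows "restrict (\<lambda>x. f (mix n J x w)) (cube n) \<in> juntas n k"
proof -
  let ?g = "restrict (\<lambda>x. f (mix n J x w)) (cube n)"
  have "i \<in> J" if "depends_on n ?g i" for i
  proof (rule ccontr)
    assume "i \<notin> J"
    from that obtain x where x: "i < n" "x \<in> cube n" "?g x \<noteq> ?g (x[i := \<not> x ! i])"
      unfolding depends_on_def by blast
    have "mix n J (x[i := \<not> x ! i]) w = mix n J x w"
      using \<open>i \<notin> J\<close> by (auto simp: mix_def) (metis nth_list_update_neq)+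
    with x show False by (simp add: cube_def)
  qed
  then have "card {i. depends_on n ?g i} \<le> card J"
    using assms by (intro card_mono) auto
  with assms show ?thesis by (simp add: juntas_def bool_funs_def)
qed

text \<open>For each fixed \<open>w\<close> the function reading only \<open>J\<close> is a junta,
  hence at distance at least \<epsilon>; the average of these distances over \<open>w\<close> is
  twice the escape probability.\<close>

lemma escape_ge_of_far:
  assumes far: "rel_dist_class n f (juntas n k) \<ge> \<epsilon>"
    and "finite J" "card J \<le> k"
  shows "escape n f J \<ge> \<epsilon> / 2"
proof -
  let ?g = "\<lambda>w. restrict (\<lambda>x. f (mix n J x w)) (cube n)"
  have "finite (juntas n k)"
    using finite_bool_funs by (simp add: juntas_def)
  then have "\<epsilon> \<le> rel_dist n f (?g w)" for w
    using far mix_in_juntas[OF assms(2,3)] unfolding rel_dist_class_def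
    by (meson Min_le finite_imageI image_eqI order_trans)
  then have "(\<Sum>w\<in>cube n. \<epsilon>) \<le> (\<Sum>w\<in>cube n. rel_dist n f (?g w))"
    by (intro sum_mono) auto
  also have "\<dots> = (\<Sum>w\<in>cube n. \<Sum>x\<in>cube n. of_bool (f x \<noteq> f (mix n J x w)))
      / real (card (sat n f))"
    unfolding rel_dist_eq sum_divide_distrib by (intro sum.cong arg_cong2[of _ _ _ _ "(/)"]) auto
  also have "\<dots> = 2 * 2 ^ n * escape n f J"
    unfolding sum_disagreement_mix escape_def by simp
  finally show ?thesis by (simp add: card_cube)
qed

section \<open>Fourier weights\<close>

text \<open>The Walsh character of \<open>S\<close>.\<close>

definition chi :: "nat set \<Rightarrow> bool list \<Rightarrow> real" where
  "chi S x = (\<Prod>i\<in>S. if x ! i then -1 else 1)"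

text \<open>The sum expands a product of factors \<open>?s i + 1\<close>, where \<open>?s i\<close>
  is 1 on agreement and -1 otherwise; a single disagreement annihilates it.\<close>

lemma sum_chi_mult:
  assumes "finite J"
  shows "(\<Sum>S\<in>Pow J. chi S x * chi S y) = (if \<forall>i\<in>J. x ! i = y ! i then 2 ^ card J else 0)"
proof -
  let ?s = "\<lambda>i. (if x ! i then -1 else 1) * (if y ! i then -1 else 1) :: real"
  have "(\<Sum>S\<in>Pow J. chi S x * chi S y) = (\<Prod>i\<in>J. ?s i + 1)"
    by (subst prod_add) (simp_all add: assms chi_def prod.distrib)
  also have "\<dots> = (\<Prod>i\<in>J. if x ! i = y ! i then 2 else 0)"
    by (intro prod.cong) auto
  also have "\<dots> = (if \<forall>i\<in>J. x ! i = y ! i then 2 ^ card J else 0)"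
    using assms by (auto intro!: prod_zero)
  finally show ?thesis .
qed

text \<open>The squared Fourier coefficient of the 0/1-valued \<open>f\<close> divided by the mean
  of \<open>f\<close>, so that over all subsets of the variables the weights sum to 1.\<close>

definition fourier_weight :: "nat \<Rightarrow> (bool list \<Rightarrow> bool) \<Rightarrow> nat set \<Rightarrow> real" where
  "fourier_weight n f S = (\<Sum>x\<in>sat n f. chi S x)\<^sup>2 / (real (card (sat n f)) * 2 ^ n)"

text \<open>Outside \<open>J\<close> the bits of \<open>w\<close> are forced to be those of
  \<open>y\<close>, inside \<open>J\<close> they are free.\<close>

lemma card_mix_fibre:
  assumes "J \<subseteq> {..<n}" "y \<in> cube n"
  shows "card {w \<in> cube n. mix n J x w = y} = (if \<forall>i\<in>J. x ! i = y ! i then 2 ^ card J else 0)"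
proof (cases "\<forall>i\<in>J. x ! i = y ! i")
  case True
  have "bij_betw (\<lambda>w. {i \<in> J. w ! i}) {w \<in> cube n. mix n J x w = y} (Pow J)"
  proof (rule bij_betw_byWitness[where f' = "\<lambda>A. mix n J (map (\<lambda>i. i \<in> A) [0..<n]) y"])
    show "\<forall>w\<in>{w \<in> cube n. mix n J x w = y}.
        mix n J (map (\<lambda>i. i \<in> {i \<in> J. w ! i}) [0..<n]) y = w"
      by (auto intro!: cube_eqI[of _ n] split: if_splits)
    show "\<forall>A\<in>Pow J. {i \<in> J. mix n J (map (\<lambda>i. i \<in> A) [0..<n]) y ! i} = A"
      using assms(1) by (auto simp: subset_iff)
    show "(\<lambda>A. mix n J (map (\<lambda>i. i \<in> A) [0..<n]) y) ` Pow J \<subseteq> {w \<in> cube n. mix n J x w = y}"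
      using assms True by (auto intro!: cube_eqI[of _ n] split: if_splits)
  qed auto
  then have "card {w \<in> cube n. mix n J x w = y} = card (Pow J)"
    by (rule bij_betw_same_card)
  with True show ?thesis
    using assms(1) by (simp add: card_Pow finite_subset)
next
  case False
  then have empty: "{w \<in> cube n. mix n J x w = y} = {}"
    using assms(1) by auto
  show ?thesis
    unfolding empty using False by simp
qed

text \<open>Parseval's identity for the average of \<open>f\<close> over the coordinates outside \<open>J\<close>.\<close>

lemma sum_fourier_weight:
  assumes "J \<subseteq> {..<n}" "sat n f \<noteq> {}"
  shows "(\<Sum>S\<in>Pow J. fourier_weight n f S) = 1 - escape n f J"
proof -
  let ?s = "real (card (sat n f))"
  have s: "?s > 0" using assms(2) by (simp add: card_gt_0_iff)
  have "(\<Sum>S\<in>Pow J. (\<Sum>x\<in>sat n f. chi S x)\<^sup>2)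
      = (\<Sum>x\<in>sat n f. \<Sum>y\<in>sat n f. \<Sum>S\<in>Pow J. chi S x * chi S y)"
    unfolding power2_eq_square sum_product
    by (subst sum.swap) (intro sum.cong refl sum.swap)
  \<comment> \<open>The character correlation of \<open>x\<close> and \<open>y\<close> is exactly
    the number of \<open>w\<close> that rerandomize \<open>x\<close> into \<open>y\<close>; summing
    over satisfying \<open>y\<close> then counts the \<open>w\<close> that keep \<open>f\<close>
    true.\<close>
  also have "\<dots> = (\<Sum>x\<in>sat n f. \<Sum>y\<in>sat n f. real (card {w \<in> cube n. mix n J x w = y}))"
    using assms(1) by (intro sum.cong refl)
      (simp add: sum_chi_mult finite_subset card_mix_fibre sat_def)
  also have "\<dots> = (\<Sum>x\<in>sat n f. \<Sum>y\<in>sat n f. \<Sum>w\<in>cube n. of_bool (mix n J x w = y))"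
    by (simp add: sum.If_cases of_bool_def Int_def)
  also have "\<dots> = (\<Sum>x\<in>sat n f. \<Sum>w\<in>cube n. \<Sum>y\<in>sat n f. of_bool (mix n J x w = y))"
    by (intro sum.cong refl sum.swap)
  also have "\<dots> = (\<Sum>x\<in>sat n f. \<Sum>w\<in>cube n. 1 - of_bool (\<not> f (mix n J x w)))"
    by (intro sum.cong refl) (simp add: of_bool_def sum.delta sat_def)
  also have "\<dots> = ?s * 2 ^ n - (\<Sum>x\<in>sat n f. \<Sum>w\<in>cube n. of_bool (\<not> f (mix n J x w)))"
    by (simp add: sum_subtractf card_cube)
  also have "\<dots> = ?s * 2 ^ n * (1 - escape n f J)"
    using s by (simp add: escape_def field_simps)
  finally show ?thesis
    using s assms(2) by (simp add: fourier_weight_def flip: sum_divide_distrib)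
qed

lemma fourier_weight_nonneg: "fourier_weight n f S \<ge> 0"
  by (simp add: fourier_weight_def)

section \<open>Random colourings\<close>

text \<open>Forgetting the colour of \<open>j\<close> is a bijection onto colourings of the other
  variables, since \<open>c i\<close> restores it.\<close>

lemma card_colourings_eq:
  fixes i j n r :: nat
  assumes "i < n" "j < n" "i \<noteq> j"
  shows "r * card {c \<in> {..<n} \<rightarrow>\<^sub>E {..<r}. c i = c j} = card ({..<n} \<rightarrow>\<^sub>E {..<r})"
proof -
  let ?I = "{..<n} - {j}"
  have "bij_betw (\<lambda>c. restrict c ?I) {c \<in> {..<n} \<rightarrow>\<^sub>E {..<r}. c i = c j} (?I \<rightarrow>\<^sub>E {..<r})"
  proof (rule bij_betw_byWitness[where f' = "\<lambda>c. c(j := c i)"])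
    show "\<forall>c\<in>{c \<in> {..<n} \<rightarrow>\<^sub>E {..<r}. c i = c j}. (restrict c ?I)(j := restrict c ?I i) = c"
    proof (intro ballI ext)
      fix c x assume "c \<in> {c \<in> {..<n} \<rightarrow>\<^sub>E {..<r}. c i = c j}"
      then show "((restrict c ?I)(j := restrict c ?I i)) x = c x"
        using assms PiE_arb[of c "{..<n}" "\<lambda>_. {..<r}" x] by auto
    qed
    show "\<forall>c\<in>?I \<rightarrow>\<^sub>E {..<r}. restrict (c(j := c i)) ?I = c"
    proof (intro ballI ext)
      fix c x assume "c \<in> ?I \<rightarrow>\<^sub>E {..<r}"
      then show "restrict (c(j := c i)) ?I x = c x"
        using PiE_arb[of c ?I "\<lambda>_. {..<r}" x] by auto
    qed
    show "(\<lambda>c. restrict c ?I) ` {c \<in> {..<n} \<rightarrow>\<^sub>E {..<r}. c i = c j} \<subseteq> ?I \<rightarrow>\<^sub>E {..<r}"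
      by (intro image_subsetI) (auto simp: PiE_iff)
    show "(\<lambda>c. c(j := c i)) ` (?I \<rightarrow>\<^sub>E {..<r}) \<subseteq> {c \<in> {..<n} \<rightarrow>\<^sub>E {..<r}. c i = c j}"
    proof (intro image_subsetI CollectI conjI)
      fix c assume c: "c \<in> ?I \<rightarrow>\<^sub>E {..<r}"
      have "c(j := c i) \<in> insert j ?I \<rightarrow>\<^sub>E {..<r}"
        using PiE_fun_upd[of "c i" "\<lambda>_. {..<r}" j c ?I] c assms PiE_mem[OF c, of i] by auto
      also have "insert j ?I = {..<n}" using assms by auto
      finally show "c(j := c i) \<in> {..<n} \<rightarrow>\<^sub>E {..<r}" .
    qed (use assms in auto)
  qed
  then have "card {c \<in> {..<n} \<rightarrow>\<^sub>E {..<r}. c i = c j} = card (?I \<rightarrow>\<^sub>E {..<r})"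
    by (rule bij_betw_same_card)
  moreover have "card (?I \<rightarrow>\<^sub>E {..<r}) = r ^ (n - 1)"
    using assms by (simp add: card_PiE)
  moreover have "r * r ^ (n - 1) = r ^ n"
    using assms by (cases n) auto
  ultimately show ?thesis
    by (simp add: card_PiE)
qed

lemma sum_colourings_eq:
  fixes i j n r :: nat
  assumes "i < n" "j < n" "i \<noteq> j" "r > 0"
  shows "(\<Sum>c\<in>{..<n} \<rightarrow>\<^sub>E {..<r}. of_bool (c i = c j) :: real)
           = real (card ({..<n} \<rightarrow>\<^sub>E {..<r})) / real r"
proof -
  have "finite ({..<n} \<rightarrow>\<^sub>E {..<r})" by (intro finite_PiE) auto
  then have "(\<Sum>c\<in>{..<n} \<rightarrow>\<^sub>E {..<r}. of_bool (c i = c j) :: real)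
      = real (card {c \<in> {..<n} \<rightarrow>\<^sub>E {..<r}. c i = c j})"
    by (simp add: of_bool_def sum.If_cases Int_def)
  moreover have "real r * real (card {c \<in> {..<n} \<rightarrow>\<^sub>E {..<r}. c i = c j})
      = real (card ({..<n} \<rightarrow>\<^sub>E {..<r}))"
    unfolding of_nat_mult[symmetric] by (simp only: card_colourings_eq[OF assms(1-3)])
  ultimately show ?thesis
    using assms(4) by (simp only: eq_divide_eq) (simp add: mult.commute)
qed

text \<open>Influence truncated to Fourier levels at most \<open>k\<close>, so that the total is
  bounded by \<open>k\<close>.\<close>

definition low_influence :: "nat \<Rightarrow> nat \<Rightarrow> (nat set \<Rightarrow> real) \<Rightarrow> nat \<Rightarrow> real" where
  "low_influence n k W i = (\<Sum>S\<in>{S \<in> Pow {..<n}. card S \<le> k \<and> i \<in> S}. W S)"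

definition collision :: "nat \<Rightarrow> nat \<Rightarrow> (nat set \<Rightarrow> real) \<Rightarrow> (nat \<Rightarrow> nat) \<Rightarrow> real" where
  "collision n k W c = (\<Sum>i<n. \<Sum>j\<in>{..<n} - {i}.
     of_bool (c i = c j) * (low_influence n k W i * low_influence n k W j))"

text \<open>The weight above level \<open>k\<close> on sets that fit into \<open>k\<close> blocks;
  \<open>low_influence\<close> does not see it, so it is bounded separately.\<close>

definition squeezed :: "nat \<Rightarrow> nat \<Rightarrow> (nat set \<Rightarrow> real) \<Rightarrow> (nat \<Rightarrow> nat) \<Rightarrow> real" where
  "squeezed n k W c = (\<Sum>S\<in>{S \<in> Pow {..<n}. card S > k}. of_bool (card (c ` S) \<le> k) * W S)"

lemma sum_Un_le:
  fixes g :: "'a \<Rightarrow> real"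
  assumes "finite A" "finite B" "\<And>x. g x \<ge> 0"
  shows "sum g (A \<union> B) \<le> sum g A + sum g B"
  using assms by (simp add: sum_Un sum_nonneg)

text \<open>Omitting the maximal term leaves the smallest remainder, so one factor of the square can
  be replaced by the sum over \<open>P - {i}\<close>.\<close>

lemma sum_minus_max_squared_le:
  fixes a :: "'a \<Rightarrow> real"
  assumes "finite P" "m \<in> P" "\<And>i. a i \<ge> 0" "\<And>i. i \<in> P \<Longrightarrow> a i \<le> a m"
  shows "(\<Sum>i\<in>P - {m}. a i)\<^sup>2 \<le> (\<Sum>i\<in>P. \<Sum>j\<in>P - {i}. a i * a j)"
proof -
  have "(\<Sum>j\<in>P - {m}. a j) \<le> (\<Sum>j\<in>P - {i}. a j)" if "i \<in> P" for i
    using assms that by (simp add: sum_diff1)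
  then have "(\<Sum>i\<in>P - {m}. a i)\<^sup>2 \<le> (\<Sum>i\<in>P - {m}. a i * (\<Sum>j\<in>P - {i}. a j))"
    unfolding power2_eq_square sum_distrib_right using assms
    by (intro sum_mono mult_left_mono) auto
  also have "\<dots> \<le> (\<Sum>i\<in>P. a i * (\<Sum>j\<in>P - {i}. a j))"
    using assms by (intro sum_mono2) (auto intro!: mult_nonneg_nonneg sum_nonneg)
  finally show ?thesis by (simp add: sum_distrib_left)
qed

section \<open>Weight captured by a union of blocks, for arbitrary nonnegative weights of total at
  most 1\<close>

context
  fixes n k :: nat and W :: "nat set \<Rightarrow> real"
  assumes W_nonneg: "W S \<ge> 0" and W_total: "(\<Sum>S\<in>Pow {..<n}. W S) \<le> 1"
begin

lemma low_influence_nonneg: "low_influence n k W i \<ge> 0"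
  by (simp add: low_influence_def sum_nonneg W_nonneg)

lemma collision_nonneg: "collision n k W c \<ge> 0"
  by (simp add: collision_def sum_nonneg low_influence_nonneg)

lemma squeezed_nonneg: "squeezed n k W c \<ge> 0"
  by (simp add: squeezed_def sum_nonneg W_nonneg)

text \<open>Double counting: each set of size at most \<open>k\<close> contributes its weight once
  per element.\<close>

lemma sum_low_influence: "(\<Sum>i<n. low_influence n k W i) \<le> k"
proof -
  have "(\<Sum>i<n. low_influence n k W i)
      = (\<Sum>i<n. \<Sum>S\<in>{S \<in> Pow {..<n}. card S \<le> k}. of_bool (i \<in> S) * W S)"
    unfolding low_influence_def
    by (intro sum.cong refl sum.mono_neutral_cong_left) auto
  also have "\<dots> = (\<Sum>S\<in>{S \<in> Pow {..<n}. card S \<le> k}. (\<Sum>i<n. of_bool (i \<in> S)) * W S)"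
    unfolding sum_distrib_right by (rule sum.swap)
  also have "\<dots> = (\<Sum>S\<in>{S \<in> Pow {..<n}. card S \<le> k}. real (card S) * W S)"
  proof (intro sum.cong refl)
    fix S assume "S \<in> {S \<in> Pow {..<n}. card S \<le> k}"
    then have "{..<n} \<inter> S = S" by auto
    then have "(\<Sum>i<n. of_bool (i \<in> S)) = real (card S)"
      by (simp add: of_bool_def sum.If_cases)
    then show "(\<Sum>i<n. of_bool (i \<in> S)) * W S = real (card S) * W S" by simp
  qed
  also have "\<dots> \<le> (\<Sum>S\<in>{S \<in> Pow {..<n}. card S \<le> k}. real k * W S)"
    by (intro sum_mono mult_right_mono W_nonneg) simp
  also have "\<dots> \<le> (\<Sum>S\<in>Pow {..<n}. real k * W S)"
    by (intro sum_mono2) (auto simp: W_nonneg)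
  also have "\<dots> = real k * (\<Sum>S\<in>Pow {..<n}. W S)"
    by (rule sum_distrib_left[symmetric])
  also have "\<dots> \<le> real k"
    using mult_left_mono[OF W_total, of "real k"] by simp
  finally show ?thesis .
qed

text \<open>Two distinct variables share a colour in a fraction \<open>1 / r\<close> of the
  colourings, and the products over all pairs sum to the squared total influence.\<close>

lemma sum_collision:
  assumes "r > 0"
  shows "(\<Sum>c\<in>{..<n} \<rightarrow>\<^sub>E {..<r}. collision n k W c)
           \<le> real k ^ 2 / real r * real (card ({..<n} \<rightarrow>\<^sub>E {..<r}))"
proof -
  let ?a = "low_influence n k W" and ?C = "{..<n} \<rightarrow>\<^sub>E {..<r}"
  let ?p = "real (card ?C) / real r"
  have "(\<Sum>c\<in>?C. collision n k W c)
      = (\<Sum>i<n. \<Sum>j\<in>{..<n} - {i}. (\<Sum>c\<in>?C. of_bool (c i = c j)) * (?a i * ?a j))"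
    unfolding collision_def sum_distrib_right
    by (subst sum.swap, intro sum.cong refl, subst sum.swap) simp
  also have "\<dots> = (\<Sum>i<n. \<Sum>j\<in>{..<n} - {i}. ?p * (?a i * ?a j))"
    by (intro sum.cong refl) (simp add: sum_colourings_eq assms)
  also have "\<dots> \<le> (\<Sum>i<n. \<Sum>j<n. ?p * (?a i * ?a j))"
    by (intro sum_mono sum_mono2) (auto simp: low_influence_nonneg)
  also have "\<dots> = ?p * ((\<Sum>i<n. ?a i) * (\<Sum>i<n. ?a i))"
    by (subst sum_product) (simp only: sum_distrib_left)
  also have "\<dots> \<le> ?p * (real k * real k)"
    by (intro mult_left_mono mult_mono sum_low_influence) (auto simp: sum_nonneg low_influence_nonneg)
  finally show ?thesis by (simp add: power2_eq_square mult_ac)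
qed

lemma sum_squeezed:
  assumes "r > 0"
  shows "(\<Sum>c\<in>{..<n} \<rightarrow>\<^sub>E {..<r}. squeezed n k W c)
           \<le> real (k + 1) ^ 2 / real r * real (card ({..<n} \<rightarrow>\<^sub>E {..<r}))"
proof -
  let ?C = "{..<n} \<rightarrow>\<^sub>E {..<r}"
  let ?p = "real (card ?C) / real r"
  have *: "(\<Sum>c\<in>?C. of_bool (card (c ` S) \<le> k) :: real) \<le> real (k + 1) ^ 2 * ?p"
    if S: "S \<subseteq> {..<n}" "card S > k" for S
  proof -
    \<comment> \<open>By pigeonhole, \<open>k + 1\<close> elements already collide when
      \<open>S\<close> receives at most \<open>k\<close> colours; a union bound over pairs in
      \<open>S'\<close> does not depend on the size of \<open>S\<close>.\<close>
    from S(2) obtain S' where S': "S' \<subseteq> S" "card S' = k + 1" "finite S'"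
      by (metis Suc_eq_plus1 Suc_leI obtain_subset_with_card_n)
    have "(\<Sum>c\<in>?C. of_bool (card (c ` S) \<le> k) :: real)
        \<le> (\<Sum>c\<in>?C. \<Sum>i\<in>S'. \<Sum>j\<in>S' - {i}. of_bool (c i = c j))"
    proof (intro sum_mono)
      fix c :: "nat \<Rightarrow> nat"
      show "of_bool (card (c ` S) \<le> k) \<le> (\<Sum>i\<in>S'. \<Sum>j\<in>S' - {i}. of_bool (c i = c j) :: real)"
      proof (cases "card (c ` S) \<le> k")
        case True
        have "card (c ` S') \<le> card (c ` S)"
          using S' S finite_subset[OF S(1)] by (intro card_mono) auto
        then have "\<not> inj_on c S'"
          using True S' card_image[of c S'] by auto
        then obtain i j where ij: "i \<in> S'" "j \<in> S'" "i \<noteq> j" "c i = c j"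
          by (auto simp: inj_on_def)
        have "1 \<le> (\<Sum>j\<in>S' - {i}. of_bool (c i = c j) :: real)"
          using member_le_sum[of j "S' - {i}" "\<lambda>j. of_bool (c i = c j) :: real"] ij S' by auto
        also have "\<dots> \<le> (\<Sum>i\<in>S'. \<Sum>j\<in>S' - {i}. of_bool (c i = c j) :: real)"
          using member_le_sum[of i S' "\<lambda>i. \<Sum>j\<in>S' - {i}. of_bool (c i = c j) :: real"] ij S'
          by (auto simp: sum_nonneg)
        finally show ?thesis by simp
      qed (simp add: sum_nonneg)
    qed
    also have "\<dots> = (\<Sum>i\<in>S'. \<Sum>j\<in>S' - {i}. \<Sum>c\<in>?C. of_bool (c i = c j))"
      by (subst sum.swap, intro sum.cong refl, subst sum.swap) simp
    also have "\<dots> = (\<Sum>i\<in>S'. \<Sum>j\<in>S' - {i}. ?p)"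
      using S S' by (intro sum.cong refl sum_colourings_eq assms) auto
    also have "\<dots> \<le> (\<Sum>i\<in>S'. \<Sum>j\<in>S'. ?p)"
      using S' by (intro sum_mono sum_mono2) auto
    also have "\<dots> = real (k + 1) ^ 2 * ?p"
      using S' by (simp add: power2_eq_square)
    finally show ?thesis .
  qed
  have "(\<Sum>c\<in>?C. squeezed n k W c)
      = (\<Sum>S\<in>{S \<in> Pow {..<n}. card S > k}. (\<Sum>c\<in>?C. of_bool (card (c ` S) \<le> k)) * W S)"
    unfolding squeezed_def sum_distrib_right by (rule sum.swap)
  also have "\<dots> \<le> (\<Sum>S\<in>{S \<in> Pow {..<n}. card S > k}. real (k + 1) ^ 2 * ?p * W S)"
    by (intro sum_mono mult_right_mono * W_nonneg) auto
  also have "\<dots> \<le> (\<Sum>S\<in>Pow {..<n}. real (k + 1) ^ 2 * ?p * W S)"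
    by (intro sum_mono2) (auto simp: W_nonneg)
  also have "\<dots> \<le> real (k + 1) ^ 2 * ?p"
    using W_total mult_left_mono[of "\<Sum>S\<in>Pow {..<n}. W S" 1 "real (k + 1) ^ 2 * ?p"]
    by (simp add: sum_distrib_left)
  finally show ?thesis by simp
qed

text \<open>In a block, the squared total influence of all variables but the most influential one is at
  most the sum of the off-diagonal products, hence bounded by \<open>collision\<close>.\<close>

lemma weight_union_blocks_le:
  assumes T: "finite T" "card T \<le> k"
    and small: "squeezed n k W c \<le> \<eta>" "k * collision n k W c \<le> \<eta>\<^sup>2" "\<eta> \<ge> 0"
    and junta: "\<And>J'. J' \<subseteq> {..<n} \<Longrightarrow> card J' \<le> k \<Longrightarrow> (\<Sum>S\<in>Pow J'. W S) \<le> \<mu>"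
  shows "(\<Sum>S\<in>Pow {i. i < n \<and> c i \<in> T}. W S) \<le> \<mu> + 2 * \<eta>"
proof -
  let ?a = "low_influence n k W"
  define J where "J = {i. i < n \<and> c i \<in> T}"
  define P where "P t = {i \<in> J. c i = t}" for t
  have J: "J \<subseteq> {..<n}" "finite J" "c ` J \<subseteq> T" by (auto simp: J_def)
  have cJ: "card (c ` J) \<le> k"
    using card_mono[OF T(1) J(3)] T(2) by simp
  have P: "finite (P t)" "P t \<subseteq> J" for t using J by (auto simp: P_def)
  have "\<exists>m\<in>P t. \<forall>i\<in>P t. ?a i \<le> ?a m" if "t \<in> c ` J" for t
  proof -
    have "P t \<noteq> {}" using that by (auto simp: P_def)
    then have "Max (?a ` P t) \<in> ?a ` P t" using P by (intro Max_in) auto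
    then obtain m where "m \<in> P t" "?a m = Max (?a ` P t)" by (metis imageE)
    then show ?thesis using P by (metis Max_ge finite_imageI imageI)
  qed
  then obtain m where m: "\<And>t. t \<in> c ` J \<Longrightarrow> m t \<in> P t"
    and m_max: "\<And>t i. t \<in> c ` J \<Longrightarrow> i \<in> P t \<Longrightarrow> ?a i \<le> ?a (m t)" by metis
  \<comment> \<open>One most influential variable per block: at most \<open>k\<close> variables, so
    \<open>junta\<close> applies to \<open>J'\<close>.\<close>
  define J' where "J' = m ` c ` J"
  have J': "J' \<subseteq> J" "card J' \<le> k"
    using m P order_trans[OF card_image_le[of "c ` J" m] cJ] J by (auto simp: J'_def)
  have discarded: "(\<Sum>i\<in>J - J'. ?a i) \<le> \<eta>"
  proof (rule power2_le_imp_le[OF _ small(3)])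
    have "(\<Sum>i\<in>J - J'. ?a i) = (\<Sum>t\<in>c ` (J - J'). \<Sum>i\<in>{i \<in> J - J'. c i = t}. ?a i)"
      using J by (intro sum.image_gen) auto
    also have "\<dots> = (\<Sum>t\<in>c ` J. \<Sum>i\<in>{i \<in> J - J'. c i = t}. ?a i)"
    proof (intro sum.mono_neutral_left ballI)
      fix t assume "t \<in> c ` J - c ` (J - J')"
      then have "{i \<in> J - J'. c i = t} = {}" by blast
      then show "(\<Sum>i\<in>{i \<in> J - J'. c i = t}. ?a i) = 0" by (simp only: sum.empty)
    qed (use J in auto)
    also have "\<dots> = (\<Sum>t\<in>c ` J. \<Sum>i\<in>P t - {m t}. ?a i)"
    proof (intro sum.cong refl)
      fix t assume "t \<in> c ` J"
      then show "{i \<in> J - J'. c i = t} = P t - {m t}"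
        using m by (auto simp: P_def J'_def)
    qed
    \<comment> \<open>Cauchy-Schwarz over the at most \<open>k\<close> blocks; this is the source of
      the factor \<open>k\<close> in the hypothesis on \<open>collision\<close>.\<close>
    finally have "(\<Sum>i\<in>J - J'. ?a i)\<^sup>2 \<le> (\<Sum>t\<in>c ` J. (\<Sum>i\<in>P t - {m t}. ?a i)\<^sup>2) * card (c ` J)"
      using sum_squared_le_sum_of_squares[of "\<lambda>t. \<Sum>i\<in>P t - {m t}. ?a i" "c ` J"] by simp
    also have "\<dots> \<le> (\<Sum>t\<in>c ` J. (\<Sum>i\<in>P t - {m t}. ?a i)\<^sup>2) * k"
      using cJ by (intro mult_left_mono) (auto simp: sum_nonneg)
    also have "\<dots> \<le> collision n k W c * k"
    proof (intro mult_right_mono)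
      have "(\<Sum>t\<in>c ` J. (\<Sum>i\<in>P t - {m t}. ?a i)\<^sup>2)
          \<le> (\<Sum>t\<in>c ` J. \<Sum>i\<in>P t. \<Sum>j\<in>P t - {i}. ?a i * ?a j)"
        using m m_max P by (intro sum_mono sum_minus_max_squared_le low_influence_nonneg) auto
      also have "\<dots> \<le> (\<Sum>t\<in>c ` J. \<Sum>i\<in>P t. \<Sum>j\<in>{..<n} - {i}. of_bool (c i = c j) * (?a i * ?a j))"
      proof (intro sum_mono)
        fix t i assume "i \<in> P t"
        then have "(\<Sum>j\<in>P t - {i}. ?a i * ?a j)
            = (\<Sum>j\<in>P t - {i}. of_bool (c i = c j) * (?a i * ?a j))"
          by (intro sum.cong) (auto simp: P_def)
        also have "\<dots> \<le> (\<Sum>j\<in>{..<n} - {i}. of_bool (c i = c j) * (?a i * ?a j))"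
          using P J by (intro sum_mono2) (auto simp: low_influence_nonneg)
        finally show "(\<Sum>j\<in>P t - {i}. ?a i * ?a j)
            \<le> (\<Sum>j\<in>{..<n} - {i}. of_bool (c i = c j) * (?a i * ?a j))" .
      qed
      also have "\<dots> = (\<Sum>i\<in>J. \<Sum>j\<in>{..<n} - {i}. of_bool (c i = c j) * (?a i * ?a j))"
        unfolding P_def using J by (intro sum.image_gen[symmetric])
      also have "\<dots> \<le> collision n k W c"
        unfolding collision_def using J
        by (intro sum_mono2) (auto intro!: sum_nonneg simp: low_influence_nonneg)
      finally show "(\<Sum>t\<in>c ` J. (\<Sum>i\<in>P t - {m t}. ?a i)\<^sup>2) \<le> collision n k W c" .
    qed simp
    finally show "(\<Sum>i\<in>J - J'. ?a i)\<^sup>2 \<le> \<eta>\<^sup>2"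
      using small by (simp add: mult.commute)
  qed
  \<comment> \<open>A subset of \<open>J\<close> lies inside \<open>J'\<close>, or is larger than
    \<open>k\<close>, or is small and contains a discarded variable; the last two kinds cost at most
    \<eta> each.\<close>
  let ?big = "{S \<in> Pow J. card S > k}" and ?low = "{S \<in> Pow J. card S \<le> k \<and> \<not> S \<subseteq> J'}"
  have "(\<Sum>S\<in>?big. W S) = (\<Sum>S\<in>?big. of_bool (card (c ` S) \<le> k) * W S)"
  proof (intro sum.cong refl)
    fix S assume "S \<in> ?big"
    then have "card (c ` S) \<le> card (c ` J)" using J by (intro card_mono) auto
    with cJ show "W S = of_bool (card (c ` S) \<le> k) * W S" by simp
  qed
  also have "\<dots> \<le> squeezed n k W c"
    unfolding squeezed_def using J by (intro sum_mono2) (auto simp: W_nonneg)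
  finally have big: "(\<Sum>S\<in>?big. W S) \<le> \<eta>" using small by simp
  \<comment> \<open>Each such set is charged to the discarded variables it contains.\<close>
  have "(\<Sum>S\<in>?low. W S) \<le> (\<Sum>S\<in>?low. \<Sum>i\<in>J - J'. of_bool (i \<in> S) * W S)"
  proof (intro sum_mono)
    fix S assume "S \<in> ?low"
    then obtain i where "i \<in> S" "i \<in> J - J'" by auto
    then show "W S \<le> (\<Sum>i\<in>J - J'. of_bool (i \<in> S) * W S)"
      using member_le_sum[of i "J - J'" "\<lambda>i. of_bool (i \<in> S) * W S"] J W_nonneg by simp
  qed
  also have "\<dots> = (\<Sum>i\<in>J - J'. \<Sum>S\<in>?low. of_bool (i \<in> S) * W S)"
    by (rule sum.swap)
  also have "\<dots> = (\<Sum>i\<in>J - J'. \<Sum>S\<in>{S \<in> ?low. i \<in> S}. W S)"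
    using J by (intro sum.cong refl sum.mono_neutral_cong_right) auto
  also have "\<dots> \<le> (\<Sum>i\<in>J - J'. ?a i)"
    unfolding low_influence_def using J by (intro sum_mono sum_mono2) (auto simp: W_nonneg)
  finally have low: "(\<Sum>S\<in>?low. W S) \<le> \<eta>" using discarded by simp
  have "(\<Sum>S\<in>Pow J. W S) \<le> (\<Sum>S\<in>Pow J' \<union> (?big \<union> ?low). W S)"
    using J J' by (intro sum_mono2) (auto simp: W_nonneg finite_subset)
  also have "\<dots> \<le> (\<Sum>S\<in>Pow J'. W S) + ((\<Sum>S\<in>?big. W S) + (\<Sum>S\<in>?low. W S))"
    using J J' finite_subset[of J' J]
    by (intro order_trans[OF sum_Un_le] add_mono order_refl) (auto simp: W_nonneg)
  also have "\<dots> \<le> \<mu> + (\<eta> + \<eta>)"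
    using J J' by (intro add_mono junta big low) auto
  finally show ?thesis by (simp add: J_def)
qed

end

text \<open>Markov's inequality: \<open>V\<close> is at least 1 on every bad colouring, while its
  mean over all colourings is at most 1/6.\<close>

lemma many_good_colourings:
  fixes \<epsilon> :: real
  assumes k: "k \<ge> 1" and \<epsilon>: "0 < \<epsilon>" "\<epsilon> < 1"
    and f: "sat n f \<noteq> {}" and far: "rel_dist_class n f (juntas n k) \<ge> \<epsilon>"
    and r: "real r \<ge> 576 * (real k / \<epsilon>) ^ 3"
  shows "6 * real (card {c \<in> {..<n} \<rightarrow>\<^sub>E {..<r}.
      \<not> (\<forall>T. finite T \<and> card T \<le> k \<longrightarrow> \<epsilon> / 4 \<le> escape n f {i. i < n \<and> c i \<in> T})})
    \<le> real (card ({..<n} \<rightarrow>\<^sub>E {..<r}))"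
    (is "6 * real (card ?bad) \<le> real (card ?C)")
proof -
  let ?W = "fourier_weight n f"
  let ?X = "squeezed n k ?W" and ?Z = "collision n k ?W"
  define V where "V c = 8 / \<epsilon> * ?X c + 64 * real k / \<epsilon>\<^sup>2 * ?Z c" for c
  have W_total: "(\<Sum>S\<in>Pow {..<n}. ?W S) \<le> 1"
    using sum_fourier_weight[OF order_refl f] escape_nonneg[of n f "{..<n}"] by simp
  note W = fourier_weight_nonneg[of n f] W_total
  have X0: "?X c \<ge> 0" and Z0: "?Z c \<ge> 0" for c
    using squeezed_nonneg[OF W] collision_nonneg[OF W] by auto
  have kpos: "real k > 0" using k by simp
  have k\<epsilon>: "real k / \<epsilon> \<ge> 1" using k \<epsilon> by (simp add: field_simps)
  have "576 * (real k / \<epsilon>) ^ 3 > 0" using kpos \<epsilon> by simp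
  then have r0: "real r > 0" using r by linarith
  have fin: "finite ?C" by (intro finite_PiE) auto
  have bad: "V c \<ge> 1" if "c \<in> ?bad" for c
  proof (rule ccontr)
    assume "\<not> V c \<ge> 1"
    moreover have "8 / \<epsilon> * ?X c \<ge> 0" "64 * real k / \<epsilon>\<^sup>2 * ?Z c \<ge> 0"
      using X0[of c] Z0[of c] \<epsilon> by auto
    \<comment> \<open>The coefficients in \<open>V\<close> are chosen so that \<open>V c < 1\<close>
      gives the hypotheses of \<open>weight_union_blocks_le\<close> with \<eta> equal to
      \<open>\<epsilon> / 8\<close>; the guaranteed escape drops from \<open>\<epsilon> / 2\<close>
      to \<open>\<epsilon> / 4\<close>.\<close>
    ultimately have "8 / \<epsilon> * ?X c \<le> 1" "64 * real k / \<epsilon>\<^sup>2 * ?Z c \<le> 1"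
      unfolding V_def by linarith+
    then have XZ: "?X c \<le> \<epsilon> / 8" "real k * ?Z c \<le> (\<epsilon> / 8)\<^sup>2"
      using \<epsilon> by (simp_all add: field_simps power2_eq_square)
    from that obtain T where T: "finite T" "card T \<le> k"
      and small: "escape n f {i. i < n \<and> c i \<in> T} < \<epsilon> / 4"
      by (auto simp: not_le)
    have junta: "(\<Sum>S\<in>Pow J'. ?W S) \<le> 1 - \<epsilon> / 2" if "J' \<subseteq> {..<n}" "card J' \<le> k" for J'
      using escape_ge_of_far[OF far _ that(2)] sum_fourier_weight[OF that(1) f]
        finite_subset[OF that(1)] by simp
    have "(\<Sum>S\<in>Pow {i. i < n \<and> c i \<in> T}. ?W S) \<le> (1 - \<epsilon> / 2) + 2 * (\<epsilon> / 8)"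
      by (rule weight_union_blocks_le[OF W T XZ _ junta]) (use \<epsilon> in auto)
    moreover have "(\<Sum>S\<in>Pow {i. i < n \<and> c i \<in> T}. ?W S) = 1 - escape n f {i. i < n \<and> c i \<in> T}"
      by (rule sum_fourier_weight[OF _ f]) auto
    ultimately show False using small by simp
  qed
  have "real (card ?bad) = (\<Sum>c\<in>?bad. 1)" by simp
  also have "\<dots> \<le> (\<Sum>c\<in>?bad. V c)" by (intro sum_mono bad)
  also have "\<dots> \<le> (\<Sum>c\<in>?C. V c)"
    using fin X0 Z0 \<epsilon> by (intro sum_mono2) (auto simp: V_def)
  also have "\<dots> = 8 / \<epsilon> * (\<Sum>c\<in>?C. ?X c) + 64 * real k / \<epsilon>\<^sup>2 * (\<Sum>c\<in>?C. ?Z c)"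
    by (simp only: V_def sum.distrib sum_distrib_left)
  also have "\<dots> \<le> 8 / \<epsilon> * (real (k + 1) ^ 2 / real r * real (card ?C))
      + 64 * real k / \<epsilon>\<^sup>2 * (real k ^ 2 / real r * real (card ?C))"
    using r0 \<epsilon> by (intro add_mono mult_left_mono sum_squeezed[OF W] sum_collision[OF W]) auto
  also have "\<dots> = (8 * (real (k + 1) ^ 2 / \<epsilon>) + 64 * (real k ^ 3 / \<epsilon>\<^sup>2)) / real r * real (card ?C)"
  proof -
    have "8 / \<epsilon> * (u / \<rho> * v) + 64 * \<kappa> / \<epsilon>\<^sup>2 * (\<kappa>\<^sup>2 / \<rho> * v)
        = (8 * (u / \<epsilon>) + 64 * (\<kappa> ^ 3 / \<epsilon>\<^sup>2)) / \<rho> * v" for u v \<rho> \<kappa> :: real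
      by (simp add: add_divide_distrib distrib_right power2_eq_square power3_eq_cube mult_ac)
        (simp add: distrib_left mult_ac)
    then show ?thesis .
  qed
  \<comment> \<open>As \<open>k + 1\<close> is at most \<open>2 * k\<close>, the numerator is at
    most 8 * 4 + 64 = 96 times the cube of \<open>k / \<epsilon>\<close>, and 576 = 6 * 96.\<close>
  also have "\<dots> \<le> 1 / 6 * real (card ?C)"
  proof (intro mult_right_mono)
    have "real (k + 1) ^ 2 \<le> (2 * real k) ^ 2" using k by (intro power_mono) auto
    then have "real (k + 1) ^ 2 / \<epsilon> \<le> (4 * real k ^ 2) / \<epsilon>"
      using \<epsilon> by (intro divide_right_mono) (auto simp: power2_eq_square)
    also have "\<dots> = 4 * ((real k / \<epsilon>) ^ 2 * \<epsilon>)"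
      using \<epsilon> by (simp add: power2_eq_square)
    also have "\<dots> \<le> 4 * ((real k / \<epsilon>) ^ 2 * (real k / \<epsilon>))"
    proof -
      have "\<epsilon> \<le> real k / \<epsilon>" using k\<epsilon> \<epsilon> by linarith
      then show ?thesis by (intro mult_left_mono) auto
    qed
    finally have 1: "real (k + 1) ^ 2 / \<epsilon> \<le> 4 * (real k / \<epsilon>) ^ 3"
      by (simp add: power2_eq_square power3_eq_cube)
    have "real k ^ 3 / \<epsilon>\<^sup>2 = (real k / \<epsilon>) ^ 3 * \<epsilon>"
      using \<epsilon> by (simp add: power2_eq_square power3_eq_cube)
    also have "\<dots> \<le> (real k / \<epsilon>) ^ 3 * 1"
      using \<epsilon> by (intro mult_left_mono) auto
    finally have "8 * (real (k + 1) ^ 2 / \<epsilon>) + 64 * (real k ^ 3 / \<epsilon>\<^sup>2) \<le> 96 * (real k / \<epsilon>) ^ 3"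
      using 1 by linarith
    also have "\<dots> \<le> 1 / 6 * real r" using r by linarith
    finally show "(8 * (real (k + 1) ^ 2 / \<epsilon>) + 64 * (real k ^ 3 / \<epsilon>\<^sup>2)) / real r \<le> 1 / 6"
      using r0 by (simp add: pos_divide_le_eq)
  qed simp
  finally show ?thesis by simp
qed

section \<open>The tester\<close>

text \<open>Consecutive hybrids differ only on block \<open>t\<close>, and not at all if \<open>t \<in> T\<close>; for \<open>t = 0\<close>
  the hybrid is \<open>x\<close>, and for \<open>t\<close> above all colours only the blocks in \<open>T\<close> keep the bits of
  \<open>x\<close>. Bisection over \<open>t\<close> thus finds a block outside \<open>T\<close> with a relevant variable.\<close>

definition hybrid ::
  "nat \<Rightarrow> (nat \<Rightarrow> nat) \<Rightarrow> nat set \<Rightarrow> nat \<Rightarrow> bool list \<Rightarrow> bool list \<Rightarrow> bool list" where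
  "hybrid n c T t x w = mix n {i. c i \<in> T \<or> t \<le> c i} x w"

text \<open>Started with \<open>f\<close> true at \<open>z lo\<close> and false at
  \<open>z (lo + 2 ^ L)\<close>, the search keeps this invariant, so \<open>K\<close> receives the
  left end of a drop.\<close>

primrec bisect :: "(nat \<Rightarrow> bool list) \<Rightarrow> nat \<Rightarrow> nat \<Rightarrow> (nat \<Rightarrow> algorithm) \<Rightarrow> algorithm" where
  "bisect z 0 lo K = K lo"
| "bisect z (Suc L) lo K =
     Query (z (lo + 2 ^ L)) (\<lambda>b. bisect z L (if b then lo + 2 ^ L else lo) K)"

text \<open>\<open>T\<close> holds the colours found so far. Colours lie below \<open>2 ^ L\<close>,
  so the first query rerandomizes everything outside \<open>T\<close>. A further block found when
  \<open>card T = k\<close> is block number \<open>k + 1\<close>.\<close>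

primrec junta_loop ::
  "nat \<Rightarrow> nat \<Rightarrow> nat \<Rightarrow> (nat \<Rightarrow> nat) \<Rightarrow> nat \<Rightarrow> nat set \<Rightarrow> algorithm" where
  "junta_loop n k L c 0 T = Output Accept"
| "junta_loop n k L c (Suc m) T =
     Sample (\<lambda>x. Random (map_pmf
       (\<lambda>w. Query (hybrid n c T (2 ^ L) x w)
         (\<lambda>b. if b then junta_loop n k L c m T
               else bisect (\<lambda>t. hybrid n c T t x w) L 0
                 (\<lambda>j. if card T = k then Output Reject else junta_loop n k L c m (insert j T))))
       (pmf_of_set (cube n))))"

definition junta_tester :: "nat \<Rightarrow> nat \<Rightarrow> nat \<Rightarrow> nat \<Rightarrow> algorithm" where
  "junta_tester n k L m =
     Random (map_pmf (\<lambda>c. junta_loop n k L c m {}) (pmf_of_set ({..<n} \<rightarrow>\<^sub>E {..<2 ^ L})))"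

lemma hybrid_in_cube [simp]: "hybrid n c T t x w \<in> cube n"
  by (simp add: hybrid_def)

section \<open>Counting oracle calls\<close>

lemma calls_at_most_mono:
  assumes "calls_at_most n q A" "q \<le> q'"
  shows "calls_at_most n q' A"
  using assms
proof (induction arbitrary: q' rule: calls_at_most.induct)
  case (Query x q c)
  then obtain p where "q' = Suc p" "q \<le> p" by (cases q') auto
  with Query show ?case by (auto intro: calls_at_most.Query)
next
  case (Sample q c)
  then obtain p where "q' = Suc p" "q \<le> p" by (cases q') auto
  with Sample show ?case by (auto intro: calls_at_most.Sample)
qed (auto intro: calls_at_most.intros)

lemma calls_bisect:
  assumes "\<And>t. z t \<in> cube n" "\<And>j. calls_at_most n q (K j)"
  shows "calls_at_most n (L + q) (bisect z L lo K)"
proof (induction L arbitrary: lo)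
  case 0
  then show ?case using assms by simp
next
  case (Suc L)
  then show ?case using assms(1) by (auto intro: calls_at_most.Query)
qed

text \<open>An iteration costs one sample, one query of the rerandomized point and at most
  \<open>L\<close> bisection queries; monotonicity covers the branch without bisection.\<close>

lemma calls_junta_loop: "calls_at_most n (m * (L + 2)) (junta_loop n k L c m T)"
proof (induction m arbitrary: T)
  case 0
  then show ?case by (simp add: calls_at_most.Output)
next
  case (Suc m)
  let ?q = "L + m * (L + 2)"
  have "calls_at_most n (Suc (Suc ?q)) (junta_loop n k L c (Suc m) T)"
    unfolding junta_loop.simps
  proof (intro calls_at_most.Sample calls_at_most.Random)
    fix x A
    assume "A \<in> set_pmf (map_pmf
       (\<lambda>w. Query (hybrid n c T (2 ^ L) x w)
         (\<lambda>b. if b then junta_loop n k L c m T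
               else bisect (\<lambda>t. hybrid n c T t x w) L 0
                 (\<lambda>j. if card T = k then Output Reject else junta_loop n k L c m (insert j T))))
       (pmf_of_set (cube n)))"
    then obtain w where A: "A = Query (hybrid n c T (2 ^ L) x w)
         (\<lambda>b. if b then junta_loop n k L c m T
               else bisect (\<lambda>t. hybrid n c T t x w) L 0
                 (\<lambda>j. if card T = k then Output Reject else junta_loop n k L c m (insert j T)))"
      by auto
    have "calls_at_most n ?q (junta_loop n k L c m T)"
      by (rule calls_at_most_mono[OF Suc.IH]) simp
    moreover have "calls_at_most n ?q (bisect (\<lambda>t. hybrid n c T t x w) L 0
                 (\<lambda>j. if card T = k then Output Reject else junta_loop n k L c m (insert j T)))"
      by (rule calls_bisect) (auto simp del: mult_Suc_right add_2_eq_Suc' intro: Suc.IH calls_at_most.Output)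
    ultimately show "calls_at_most n (Suc ?q) A"
      unfolding A by (intro calls_at_most.Query) auto
  qed
  then show ?case by (simp add: algebra_simps)
qed

lemma calls_junta_tester: "calls_at_most n (m * (L + 2)) (junta_tester n k L m)"
  unfolding junta_tester_def by (rule calls_at_most.Random) (auto simp del: mult_Suc_right add_2_eq_Suc' intro: calls_junta_loop)

section \<open>Output distribution of the tester\<close>

lemma run_bisect:
  assumes "f (z lo)" "\<not> f (z (lo + 2 ^ L))"
  shows "\<exists>p. p < lo + 2 ^ L \<and> f (z p) \<and> \<not> f (z (Suc p)) \<and> run n f (bisect z L lo K) = run n f (K p)"
  using assms
proof (induction L arbitrary: lo)
  case 0
  then show ?case by auto
next
  case (Suc L)
  show ?case
  proof (cases "f (z (lo + 2 ^ L))")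
    case True
    with Suc.IH[of "lo + 2 ^ L"] Suc.prems show ?thesis
      by (simp add: add.assoc mult_2[symmetric])
  next
    case False
    with Suc.IH[of lo] Suc.prems obtain p where p: "p < lo + 2 ^ L" "f (z p)" "\<not> f (z (Suc p))"
      "run n f (bisect z L lo K) = run n f (K p)" by blast
    have "lo + 2 ^ L \<le> lo + (2 :: nat) ^ Suc L" by simp
    with p(1) have "p < lo + 2 ^ Suc L" by (rule less_le_trans)
    with p False show ?thesis by (intro exI[of _ p]) simp
  qed
qed

lemma run_Random_of_set:
  "run n f (Random (map_pmf B (pmf_of_set S))) = bind_pmf (pmf_of_set S) (\<lambda>w. run n f (B w))"
  by (simp add: pmf.map_comp o_def bind_map_pmf join_eq_bind_pmf)

text \<open>Bisection ends at consecutive hybrids with different values of \<open>f\<close>. They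
  differ at a relevant variable, and only variables of colour \<open>p\<close> outside
  \<open>T\<close> can differ, so the block found is new.\<close>

lemma run_iteration:
  fixes c :: "nat \<Rightarrow> nat"
  assumes c: "\<And>i. i < n \<Longrightarrow> c i < 2 ^ L" and x: "x \<in> sat n f"
    and y: "\<not> f (hybrid n c T (2 ^ L) x w)"
  shows "\<exists>i. depends_on n f i \<and> c i \<notin> T \<and>
      run n f (bisect (\<lambda>t. hybrid n c T t x w) L 0 K) = run n f (K (c i))"
proof -
  let ?z = "\<lambda>t. hybrid n c T t x w"
  have "?z 0 = x"
    using x by (intro cube_eqI[of _ n]) (auto simp: hybrid_def sat_def)
  then have "f (?z 0)" using x by (simp add: sat_def)
  then obtain p where p: "f (?z p)" "\<not> f (?z (Suc p))"
      "run n f (bisect ?z L 0 K) = run n f (K p)"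
    using run_bisect[of f ?z 0 L n K] y by auto
  then obtain i where i: "i < n" "?z p ! i \<noteq> ?z (Suc p) ! i" "depends_on n f i"
    using depends_on_of_neq[of "?z p" n "?z (Suc p)" f] by auto
  then have "c i \<notin> T" "c i = p"
    by (auto simp: hybrid_def split: if_splits)
  with i p show ?thesis by blast
qed

text \<open>Every colour in \<open>T\<close> is that of a relevant variable. A new one can be found
  only while \<open>card T < k\<close>, so the rejecting branch is never reached.\<close>

lemma run_junta_loop_of_junta:
  assumes f: "f \<in> juntas n k" "sat n f \<noteq> {}"
    and c: "\<And>i. i < n \<Longrightarrow> c i < 2 ^ L"
    and T: "T \<subseteq> c ` {i. depends_on n f i}"
  shows "run n f (junta_loop n k L c m T) = return_pmf Accept"
  using T
proof (induction m arbitrary: T)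
  case 0
  then show ?case by simp
next
  case (Suc m)
  let ?D = "{i. depends_on n f i}"
  have D: "finite ?D" "card ?D \<le> k"
    using f(1) finite_subset[of ?D "{..<n}"] by (auto simp: juntas_def depends_on_def)
  have "run n f (junta_loop n k L c (Suc m) T)
      = bind_pmf (pmf_of_set (sat n f)) (\<lambda>x. bind_pmf (pmf_of_set (cube n)) (\<lambda>w. return_pmf Accept))"
    unfolding junta_loop.simps run.simps(3) run_Random_of_set
  proof (intro bind_pmf_cong refl)
    fix x w assume "x \<in> set_pmf (pmf_of_set (sat n f))"
    then have x: "x \<in> sat n f" using f(2) by simp
    let ?K = "\<lambda>j. if card T = k then Output Reject else junta_loop n k L c m (insert j T)"
    have "run n f (bisect (\<lambda>t. hybrid n c T t x w) L 0 ?K) = return_pmf Accept"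
      if y: "\<not> f (hybrid n c T (2 ^ L) x w)"
    proof -
      obtain i where i: "depends_on n f i" "c i \<notin> T"
        "run n f (bisect (\<lambda>t. hybrid n c T t x w) L 0 ?K) = run n f (?K (c i))"
        using run_iteration[OF c x y] by blast
      have sub: "insert (c i) T \<subseteq> c ` ?D" using Suc.prems i by auto
      have "finite T" using Suc.prems D by (auto intro: finite_subset)
      then have "card T < card (insert (c i) T)" using i by simp
      also have "\<dots> \<le> card ?D"
        using card_mono[OF _ sub] card_image_le[OF D(1), of c] D by simp
      finally have "card T \<noteq> k" using D by simp
      then show ?thesis using i Suc.IH[OF sub] by simp
    qed
    then show "run n f (Query (hybrid n c T (2 ^ L) x w)
         (\<lambda>b. if b then junta_loop n k L c m T
               else bisect (\<lambda>t. hybrid n c T t x w) L 0 ?K)) = return_pmf Accept"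
      using Suc.IH[OF Suc.prems] by simp
  qed
  then show ?case by simp
qed

text \<open>The bound is that of the exponential moment \<open>2\<close> to the minus number of blocks found, which
  each iteration multiplies by at most \<open>1 - \<delta> / 2\<close> in expectation.\<close>

lemma accept_junta_loop_le:
  assumes f: "sat n f \<noteq> {}" and c: "\<And>i. i < n \<Longrightarrow> c i < 2 ^ L"
    and \<delta>: "\<delta> \<le> 1"
    and good: "\<And>T. finite T \<Longrightarrow> card T \<le> k \<Longrightarrow> \<delta> \<le> escape n f {i. i < n \<and> c i \<in> T}"
    and T: "finite T" "card T \<le> k"
  shows "pmf (run n f (junta_loop n k L c m T)) Accept \<le> (1 - \<delta> / 2) ^ m * 2 ^ (k + 1 - card T)"
  using T
proof (induction m arbitrary: T)
  case 0
  then show ?case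
    using order_trans[OF pmf_le_1 one_le_power[of "2 :: real" "k + 1 - card T"]] by simp
next
  case (Suc m)
  let ?B = "(1 - \<delta> / 2) ^ m * 2 ^ (k + 1 - card T)"
  let ?K = "\<lambda>j. if card T = k then Output Reject else junta_loop n k L c m (insert j T)"
  let ?A = "\<lambda>x w. Query (hybrid n c T (2 ^ L) x w)
         (\<lambda>b. if b then junta_loop n k L c m T
               else bisect (\<lambda>t. hybrid n c T t x w) L 0 ?K)"
  let ?J = "{i. i < n \<and> c i \<in> T}"
  have B: "?B \<ge> 0" using \<delta> by simp
  have s: "real (card (sat n f)) > 0" using f by (simp add: card_gt_0_iff)
  \<comment> \<open>A falsifying pair either leads to rejection or enlarges \<open>T\<close>, which
    halves the power of 2; averaging the indicator over \<open>x\<close> and \<open>w\<close>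
    produces \<open>escape\<close>.\<close>
  have step: "pmf (run n f (?A x w)) Accept \<le> ?B * (1 - of_bool (\<not> f (mix n ?J x w)) / 2)"
    if x: "x \<in> sat n f" for x w
  proof -
    have hyb: "hybrid n c T (2 ^ L) x w = mix n ?J x w"
      by (rule cube_eqI[of _ n]) (auto simp: hybrid_def dest: c)
    show ?thesis
    proof (cases "f (mix n ?J x w)")
      case True
      then show ?thesis using Suc.IH[OF Suc.prems] by (simp add: hyb)
    next
      case False
      obtain i where i: "c i \<notin> T"
        "run n f (bisect (\<lambda>t. hybrid n c T t x w) L 0 ?K) = run n f (?K (c i))"
        using run_iteration[of n c L x f T w ?K] c x False hyb by auto
      have "pmf (run n f (?K (c i))) Accept \<le> ?B / 2"
      proof (cases "card T = k")
        case False
        then have "k + 1 - card T = Suc (k - card T)" using Suc.prems by simp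
        then have "?B / 2 = (1 - \<delta> / 2) ^ m * 2 ^ (k - card T)"
          by (simp only: power_Suc)
        moreover have "pmf (run n f (?K (c i))) Accept \<le> (1 - \<delta> / 2) ^ m * 2 ^ (k - card T)"
          using Suc.IH[of "insert (c i) T"] False Suc.prems i by simp
        ultimately show ?thesis by (simp only:)
      qed (use B in simp)
      then show ?thesis using False i by (simp add: hyb)
    qed
  qed
  have "pmf (run n f (junta_loop n k L c (Suc m) T)) Accept
      = (\<Sum>x\<in>sat n f. (\<Sum>w\<in>cube n. pmf (run n f (?A x w)) Accept) / 2 ^ n) / real (card (sat n f))"
    unfolding junta_loop.simps run.simps(3) run_Random_of_set
    by (subst pmf_bind_pmf_of_set, (use f in simp_all)[2],
        intro arg_cong2[of _ _ _ _ "(/)"] sum.cong refl,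
        subst pmf_bind_pmf_of_set) (simp_all add: card_cube)
  also have "\<dots> \<le> (\<Sum>x\<in>sat n f. (\<Sum>w\<in>cube n.
      ?B * (1 - of_bool (\<not> f (mix n ?J x w)) / 2)) / 2 ^ n) / real (card (sat n f))"
    by (intro divide_right_mono sum_mono step) auto
  also have "\<dots> = ?B * ((\<Sum>x\<in>sat n f. \<Sum>w\<in>cube n. 1 - of_bool (\<not> f (mix n ?J x w)) / 2)
      / (real (card (sat n f)) * 2 ^ n))"
    by (simp only: sum_distrib_left[symmetric] sum_divide_distrib[symmetric]) simp
  also have "(\<Sum>x\<in>sat n f. \<Sum>w\<in>cube n. 1 - of_bool (\<not> f (mix n ?J x w)) / 2)
      = real (card (sat n f)) * 2 ^ n
        - (\<Sum>x\<in>sat n f. \<Sum>w\<in>cube n. of_bool (\<not> f (mix n ?J x w))) / 2"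
    by (simp only: sum_subtractf sum_divide_distrib[symmetric] sum_constant card_cube) simp
  also have "\<dots> / (real (card (sat n f)) * 2 ^ n) = 1 - escape n f ?J / 2"
    using s f by (simp add: escape_def diff_divide_distrib)
  also have "?B * (1 - escape n f ?J / 2) \<le> ?B * (1 - \<delta> / 2)"
    using good[OF Suc.prems] by (intro mult_left_mono B) simp
  finally show ?case by (simp add: mult_ac)
qed

lemma reject_eq: "pmf p Reject = 1 - pmf p Accept"
proof -
  have "set_pmf p \<subseteq> {Accept, Reject}"
    using verdict.exhaust by blast
  then have "(\<Sum>v\<in>{Accept, Reject}. pmf p v) = 1"
    by (intro sum_pmf_eq_1) (rule finite.intros)+
  then show ?thesis by simp
qed

text \<open>Juntas are accepted with certainty. On far inputs the error 1/3 splits into 1/6 for a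
  bad colouring and 1/6 for acceptance under a good one.\<close>

lemma junta_tester_correct:
  fixes \<epsilon> :: real
  assumes k: "k \<ge> 1" and \<epsilon>: "0 < \<epsilon>" "\<epsilon> < 1"
    and L: "2 ^ L \<ge> 576 * (real k / \<epsilon>) ^ 3" and m: "real m \<ge> 40 * (real k / \<epsilon>)"
  shows "relative_error_tester n \<epsilon> (juntas n k) (junta_tester n k L m)"
  unfolding relative_error_tester_def
proof (intro ballI impI conjI)
  fix f assume f: "f \<in> bool_funs n" "sat n f \<noteq> {}"
  let ?C = "{..<n} \<rightarrow>\<^sub>E {..<2 ^ L :: nat}"
  have "finite ?C" by (intro finite_PiE) auto
  moreover have "(\<lambda>i\<in>{..<n}. 0) \<in> ?C" by auto
  ultimately have C: "finite ?C" "?C \<noteq> {}" by blast+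
  have c: "c i < 2 ^ L" if "c \<in> ?C" "i < n" for c i
    using PiE_mem[OF that(1), of i] that(2) by simp
  have run: "run n f (junta_tester n k L m)
      = bind_pmf (pmf_of_set ?C) (\<lambda>c. run n f (junta_loop n k L c m {}))"
    unfolding junta_tester_def run_Random_of_set ..
  {
    assume "f \<in> juntas n k"
    have "run n f (junta_tester n k L m) = bind_pmf (pmf_of_set ?C) (\<lambda>c. return_pmf Accept)"
      unfolding run
    proof (intro bind_pmf_cong refl)
      fix c assume "c \<in> set_pmf (pmf_of_set ?C)"
      then have "c \<in> ?C" using C by simp
      then show "run n f (junta_loop n k L c m {}) = return_pmf Accept"
        using run_junta_loop_of_junta[OF \<open>f \<in> juntas n k\<close> f(2)] c by blast
    qed
    then show "2 / 3 \<le> pmf (run n f (junta_tester n k L m)) Accept"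
      by simp
  }
  {
    assume far: "\<epsilon> \<le> rel_dist_class n f (juntas n k)"
    define good where "good c \<longleftrightarrow>
      (\<forall>T. finite T \<and> card T \<le> k \<longrightarrow> \<epsilon> / 4 \<le> escape n f {i. i < n \<and> c i \<in> T})"
      for c :: "nat \<Rightarrow> nat"
    have bad: "6 * real (card {c \<in> ?C. \<not> good c}) \<le> real (card ?C)"
      unfolding good_def using L by (intro many_good_colourings k \<epsilon> f far) simp
    \<comment> \<open>The constant 40 makes the power at most \<open>exp (- 5 * k)\<close>, hence at
      most \<open>1 / 2 ^ (5 * k)\<close>; as \<open>5 * k\<close> is at least \<open>k + 4\<close>,
      the product is at most 1/8.\<close>
    have "(1 - \<epsilon> / 4 / 2) ^ m * 2 ^ (k + 1) \<le> 1 / 6"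
    proof -
      have "5 * real k \<le> real m * (\<epsilon> / 8)"
        using m \<epsilon> by (simp add: field_simps)
      have "(1 - \<epsilon> / 4 / 2) ^ m \<le> exp (- (\<epsilon> / 8)) ^ m"
        using exp_ge_add_one_self[of "- (\<epsilon> / 8)"] \<epsilon> by (intro power_mono) auto
      also have "\<dots> = exp (- (real m * (\<epsilon> / 8)))"
        by (simp flip: exp_of_nat_mult)
      also have "\<dots> \<le> exp (- (5 * real k))"
        using \<open>5 * real k \<le> real m * (\<epsilon> / 8)\<close> by simp
      also have "\<dots> = 1 / exp 1 ^ (5 * k)"
        by (simp add: exp_minus field_simps flip: exp_of_nat_mult)
      also have "\<dots> \<le> 1 / 2 ^ (5 * k)"
        using exp_ge_add_one_self[of 1] by (intro divide_left_mono power_mono) auto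
      finally have "(1 - \<epsilon> / 4 / 2) ^ m * 2 ^ (k + 1) \<le> 1 / 2 ^ (5 * k) * 2 ^ (k + 1)"
        by (intro mult_right_mono) auto
      also have "\<dots> \<le> 1 / 2 ^ (k + 4) * 2 ^ (k + 1)"
        using k by (intro mult_right_mono divide_left_mono power_increasing) auto
      also have "\<dots> = 1 / 8" by (simp add: power_add)
      finally show ?thesis by simp
    qed
    then have accept: "pmf (run n f (junta_loop n k L c m {})) Accept \<le> 1 / 6"
      if "c \<in> ?C" "good c" for c
      using accept_junta_loop_le[of n f c L "\<epsilon> / 4" k "{}" m] f(2) c[OF that(1)] that(2) \<epsilon>
      by (simp add: good_def)
    have "pmf (run n f (junta_loop n k L c m {})) Accept \<le> of_bool (\<not> good c) + 1 / 6"
      if "c \<in> ?C" for c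
      using accept[OF that] pmf_le_1[of "run n f (junta_loop n k L c m {})" Accept]
      by (cases "good c") auto
    then have "(\<Sum>c\<in>?C. pmf (run n f (junta_loop n k L c m {})) Accept)
        \<le> (\<Sum>c\<in>?C. of_bool (\<not> good c) + 1 / 6)"
      by (rule sum_mono)
    also have "\<dots> = real (card {c \<in> ?C. \<not> good c}) + real (card ?C) / 6"
      using C by (simp add: sum.distrib of_bool_def sum.If_cases Int_def)
    also have "\<dots> \<le> real (card ?C) / 3" using bad by simp
    finally have "pmf (run n f (junta_tester n k L m)) Accept \<le> 1 / 3"
      unfolding run pmf_bind_pmf_of_set[OF C(2,1)]
      using C by (simp add: pos_divide_le_eq card_gt_0_iff)
    then show "2 / 3 \<le> pmf (run n f (junta_tester n k L m)) Reject"
      by (simp add: reject_eq)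
  }
qed

section \<open>Choice of the numbers of colours and iterations\<close>

theorem theorem1p1:
  "\<exists>C::real. C > 0 \<and>
     (\<forall>(k::nat) (\<epsilon>::real) (n::nat). k \<ge> 1 \<and> 0 < \<epsilon> \<and> \<epsilon> < 1/2 \<longrightarrow>
        (\<exists>A q. relative_error_tester n \<epsilon> (juntas n k) A \<and> calls_at_most n q A \<and>
           real q \<le> C * ((real k / \<epsilon>) * log 2 (real k / \<epsilon>))))"
proof (intro exI[of _ 656] conjI allI impI)
  fix k n :: nat and \<epsilon> :: real
  assume "k \<ge> 1 \<and> 0 < \<epsilon> \<and> \<epsilon> < 1/2"
  then have k: "k \<ge> 1" and \<epsilon>: "0 < \<epsilon>" "\<epsilon> < 1/2" by auto
  define s where "s = real k / \<epsilon>"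
  \<comment> \<open>The bound \<open>\<epsilon> < 1/2\<close> makes the logarithm at least 1, so it
    absorbs all additive constants below.\<close>
  have s: "s > 2" using k \<epsilon> by (simp add: s_def field_simps)
  then have log: "log 2 s \<ge> 1" by (simp add: le_log_iff)
  \<comment> \<open>The summand 10 covers the constant 576, which is below \<open>2 ^ 10\<close>,
    and the factor 3 the cube of \<open>s\<close>.\<close>
  define L where "L = nat \<lceil>10 + 3 * log 2 s\<rceil>"
  define m where "m = nat \<lceil>40 * s\<rceil>"
  have L: "10 + 3 * log 2 s \<le> real L" "real L \<le> 11 + 3 * log 2 s"
    unfolding L_def using log by linarith+
  have m: "40 * s \<le> real m" "real m \<le> 40 * s + 1"
    unfolding m_def using s by linarith+
  have "576 * s ^ 3 \<le> 2 powr 10 * s ^ 3"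
    using s by (intro mult_right_mono) auto
  also have "\<dots> = 2 powr (10 + 3 * log 2 s)"
  proof -
    have "s ^ 3 = (2 powr log 2 s) ^ 3" using s by simp
    also have "\<dots> = 2 powr (3 * log 2 s)"
      by (simp add: powr_powr mult.commute flip: powr_realpow)
    finally show ?thesis by (simp only: powr_add)
  qed
  also have "\<dots> \<le> 2 powr real L" using L by simp
  also have "\<dots> = 2 ^ L" by (simp add: powr_realpow)
  finally have "576 * s ^ 3 \<le> 2 ^ L" .
  then have "relative_error_tester n \<epsilon> (juntas n k) (junta_tester n k L m)"
    using k \<epsilon> m by (intro junta_tester_correct) (auto simp: s_def)
  \<comment> \<open>656 = 41 * 16: rounding up costs \<open>m\<close> at most one more
    \<open>s\<close>, and \<open>L + 2\<close> is at most \<open>13 + 3 * log 2 s\<close>.\<close>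
  moreover have "real (m * (L + 2)) \<le> 656 * (s * log 2 s)"
  proof -
    have "real (m * (L + 2)) \<le> (41 * s) * (16 * log 2 s)"
      unfolding of_nat_mult
    proof (rule mult_mono)
      show "real m \<le> 41 * s" using m s by linarith
      show "real (L + 2) \<le> 16 * log 2 s" using L log by simp
    qed (use s in auto)
    then show ?thesis by simp
  qed
  ultimately show "\<exists>A q. relative_error_tester n \<epsilon> (juntas n k) A \<and> calls_at_most n q A \<and>
      real q \<le> 656 * ((real k / \<epsilon>) * log 2 (real k / \<epsilon>))"
    using calls_junta_tester unfolding s_def by blast
qed simp

end
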